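(* Let $p$ be an odd prime. For non-negative integers $m$ and $n$, $$N(m,n)=\begin{cases}\displaystyle\sum_{0\le a\le\lfloor n/2\rfloor}N\left(\frac mp-a,\,n-2a\right) & \text{if } p\mid m,\\[2ex] \displaystyle\sum_{0\le a\le\lfloor n/2\rfloor}N\left(\frac{m-1}p-a,\,n-2a-1\right) & \text{if } m\equiv1\pmod p,\\[2ex] 0 & \text{otherwise.}\end{cases}$$
   Context: For integers $m,n$ and $r\ge1$, $N_r(m,n)$ is the number of pairs $(\mathfrak a,\mathfrak b)$, $\mathfrak a=(a_1,\dots,a_r)\in\mathbb N^r$, $\mathfrak b=(b_1,\dots,b_r)\in\{0,1\}^r$ (with $\mathbb N=\{0,1,2,\dots\}$), satisfying $2\sum_{i=1}^r a_i+\sum_{j=1}^r b_j=n$ and $b_1+\sum_{i=1}^{r-1}(a_i+b_{i+1})p^i+a_rp^r=m$. This number does not depend on $r$ once $p^r>m$, and $N(m,n)$ denotes this stable value; in particular $N(m,n)=0$ if $m<0$ or $n<0$. *)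

theory Defs
  imports "HOL-Number_Theory.Number_Theory" "HOL-Library.FuncSet"
begin

text \<open>Pairs of tuples indexed by \<open>1, \<dots>, r\<close>; tuples are extensional functions, so that each
  tuple is represented exactly once.\<close>

definition solutions ::
  "nat \<Rightarrow> nat \<Rightarrow> int \<Rightarrow> int \<Rightarrow> ((nat \<Rightarrow> nat) \<times> (nat \<Rightarrow> nat)) set" where
  "solutions p r m n =
    {(a, b). a \<in> {1..r} \<rightarrow>\<^sub>E UNIV \<and> b \<in> {1..r} \<rightarrow>\<^sub>E {0, 1} \<and>
       int (2 * (\<Sum>i = 1..r. a i) + (\<Sum>j = 1..r. b j)) = n \<and>
       int (b 1 + (\<Sum>i = 1..r - 1. (a i + b (i + 1)) * p ^ i) + a r * p ^ r) = m}"

definition Nr :: "nat \<Rightarrow> nat \<Rightarrow> int \<Rightarrow> int \<Rightarrow> nat" where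
  "Nr p r m n = card (solutions p r m n)"

text \<open>The common value of \<open>Nr p r m n\<close> over all \<open>r \<ge> 1\<close> with \<open>p ^ r > m\<close>;
  see \<open>N_eq_Nr\<close> below for its well-definedness.\<close>

definition N :: "nat \<Rightarrow> int \<Rightarrow> int \<Rightarrow> nat" where
  "N p m n = (THE k. \<forall>r\<ge>1. int p ^ r > m \<longrightarrow> Nr p r m n = k)"

lemma finite_solutions: "finite (solutions p r m n)"
proof (rule finite_subset)
  show "solutions p r m n \<subseteq> ({1..r} \<rightarrow>\<^sub>E {..nat n}) \<times> ({1..r} \<rightarrow>\<^sub>E {0, 1})"
  proof (clarify, intro conjI SigmaI)
    fix a b assume ab: "(a, b) \<in> solutions p r m n"
    show "b \<in> {1..r} \<rightarrow>\<^sub>E {0, 1}" using ab by (simp add: solutions_def)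
    have "a i \<le> nat n" if "i \<in> {1..r}" for i
    proof -
      have "a i \<le> (\<Sum>i = 1..r. a i)" using that by (intro member_le_sum) auto
      moreover have "n = int (2 * (\<Sum>i = 1..r. a i) + (\<Sum>j = 1..r. b j))"
        using ab by (simp only: solutions_def mem_Collect_eq case_prod_conv)
      ultimately show ?thesis by linarith
    qed
    then show "a \<in> {1..r} \<rightarrow>\<^sub>E {..nat n}" using ab by (auto simp: solutions_def PiE_def)
  qed
qed (auto intro: finite_PiE)

lemma Nr_Suc:
  assumes r: "r \<ge> 1" and m: "int p ^ r > m"
  shows "Nr p (Suc r) m n = Nr p r m n"
proof -
  obtain s where s: "r = Suc s" using r by (cases r) auto
  have zero: "a r = 0 \<and> b (Suc r) = 0 \<and> a (Suc r) = 0"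
    if ab: "(a, b) \<in> solutions p (Suc r) m n" for a b
  proof -
    have "int ((a r + b (r + 1)) * p ^ r + a (Suc r) * p ^ Suc r) \<le> m"
    proof -
      have "m = int (b 1 + (\<Sum>i = 1..Suc r - 1. (a i + b (i + 1)) * p ^ i)
          + a (Suc r) * p ^ Suc r)"
        using ab by (simp only: solutions_def mem_Collect_eq case_prod_conv)
      also have "(\<Sum>i = 1..Suc r - 1. (a i + b (i + 1)) * p ^ i) =
          (\<Sum>i = 1..s. (a i + b (i + 1)) * p ^ i) + (a r + b (r + 1)) * p ^ r"
        by (simp add: s)
      finally show ?thesis by linarith
    qed
    then have "int ((a r + b (r + 1) + a (Suc r) * p) * p ^ r) < int (p ^ r)"
      using m by (simp add: algebra_simps)
    then have "(a r + b (r + 1) + a (Suc r) * p) * p ^ r < 1 * p ^ r"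
      by (metis nat_mult_1 of_nat_less_iff)
    then have "a r + b (r + 1) + a (Suc r) * p < 1" and "p ^ r > 0"
      unfolding mult_less_cancel2 by auto
    moreover from this(2) have "p > 0" using r by (cases "p = 0") auto
    ultimately show ?thesis by auto
  qed
  have zero': "a r = 0" if ab: "(a, b) \<in> solutions p r m n" for a b
  proof -
    have "m = int (b 1 + (\<Sum>i = 1..r - 1. (a i + b (i + 1)) * p ^ i) + a r * p ^ r)"
      using ab by (simp only: solutions_def mem_Collect_eq case_prod_conv)
    then have "int (a r * p ^ r) \<le> m" by linarith
    then have "int (a r * p ^ r) < int (1 * p ^ r)" using m by simp
    then show ?thesis by (simp only: of_nat_less_iff mult_less_cancel2) simp
  qed
  let ?f = "\<lambda>(a, b). (restrict a {1..r}, restrict b {1..r})"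
  let ?g = "\<lambda>(a, b). (a(Suc r := 0), b(Suc r := 0))"
  have f_mem: "?f (a, b) \<in> solutions p r m n" if ab: "(a, b) \<in> solutions p (Suc r) m n" for a b
  proof -
    have "restrict a {1..r} \<in> {1..r} \<rightarrow>\<^sub>E UNIV" "restrict b {1..r} \<in> {1..r} \<rightarrow>\<^sub>E {0, 1}"
      using ab by (auto simp: solutions_def PiE_def Pi_def)
    moreover have "(\<Sum>i = 1..r - 1. (restrict a {1..r} i + restrict b {1..r} (i + 1)) * p ^ i)
        = (\<Sum>i = 1..r - 1. (a i + b (i + 1)) * p ^ i)"
      by (intro sum.cong) auto
    moreover have "(\<Sum>i = 1..Suc r - 1. (a i + b (i + 1)) * p ^ i) =
        (\<Sum>i = 1..r - 1. (a i + b (i + 1)) * p ^ i)"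
      using zero[OF ab] by (simp add: s)
    ultimately show ?thesis
      using ab zero[OF ab] r
      by (simp add: solutions_def del: of_nat_add of_nat_mult of_nat_sum)
  qed
  have g_mem: "?g (a, b) \<in> solutions p (Suc r) m n" if ab: "(a, b) \<in> solutions p r m n" for a b
  proof -
    have "a(Suc r := 0) \<in> {1..Suc r} \<rightarrow>\<^sub>E UNIV" "b(Suc r := 0) \<in> {1..Suc r} \<rightarrow>\<^sub>E {0, 1}"
      using ab by (auto simp: solutions_def PiE_def Pi_def extensional_def)
    moreover have "(\<Sum>i = 1..Suc r - 1. ((a(Suc r := 0)) i + (b(Suc r := 0)) (i + 1)) * p ^ i) =
        (\<Sum>i = 1..r - 1. (a i + b (i + 1)) * p ^ i)"
      using zero'[OF ab] by (simp add: s)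
    moreover have "(\<Sum>i = 1..Suc r. (c(Suc r := 0)) i) = (\<Sum>i = 1..r. c i)" for c :: "nat \<Rightarrow> nat"
      by simp
    ultimately show ?thesis
      using ab zero'[OF ab] r
      by (simp add: solutions_def del: of_nat_add of_nat_mult of_nat_sum sum.cl_ivl_Suc)
  qed
  have gf: "?g (?f (a, b)) = (a, b)" if ab: "(a, b) \<in> solutions p (Suc r) m n" for a b
  proof -
    have "a \<in> extensional {1..Suc r}" "b \<in> extensional {1..Suc r}"
      using ab by (auto simp: solutions_def PiE_def)
    then show ?thesis
      using zero[OF ab] by (auto simp: fun_eq_iff extensional_def)
  qed
  have fg: "?f (?g (a, b)) = (a, b)" if ab: "(a, b) \<in> solutions p r m n" for a b
  proof -
    have "a \<in> extensional {1..r}" "b \<in> extensional {1..r}"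
      using ab by (auto simp: solutions_def PiE_def)
    then show ?thesis by (auto simp: fun_eq_iff extensional_def)
  qed
  have "bij_betw ?f (solutions p (Suc r) m n) (solutions p r m n)"
  proof (rule bij_betw_byWitness[where f' = ?g])
    show "\<forall>x \<in> solutions p (Suc r) m n. ?g (?f x) = x"
      using gf by (metis surj_pair)
    show "\<forall>x \<in> solutions p r m n. ?f (?g x) = x"
      using fg by (metis surj_pair)
    show "?f ` solutions p (Suc r) m n \<subseteq> solutions p r m n"
    proof (rule image_subsetI)
      fix x assume x: "x \<in> solutions p (Suc r) m n"
      obtain a b where ab: "x = (a, b)" by (cases x)
      show "?f x \<in> solutions p r m n" unfolding ab using x ab by (intro f_mem) simp
    qed
    show "?g ` solutions p r m n \<subseteq> solutions p (Suc r) m n"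
    proof (rule image_subsetI)
      fix x assume x: "x \<in> solutions p r m n"
      obtain a b where ab: "x = (a, b)" by (cases x)
      show "?g x \<in> solutions p (Suc r) m n" unfolding ab using x ab by (intro g_mem) simp
    qed
  qed
  then show ?thesis by (simp add: Nr_def bij_betw_same_card)
qed

lemma N_eq_Nr:
  assumes p: "p > 1" and r: "r \<ge> 1" "int p ^ r > m"
  shows "N p m n = Nr p r m n"
proof -
  have mono: "Nr p s' m n = Nr p s m n" if "s \<ge> 1" "int p ^ s > m" "s \<le> s'" for s s'
    using that(3)
  proof (induction s' rule: dec_induct)
    case (step k)
    have "int p ^ s \<le> int p ^ k" using p step.hyps by (intro power_increasing) auto
    then show ?case using Nr_Suc[of k m p n] step that by simp
  qed simp
  have "Nr p s m n = Nr p r m n" if "s \<ge> 1" "int p ^ s > m" for s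
    using mono[of s r] mono[of r s] that r by (cases "s \<le> r") auto
  then show ?thesis unfolding N_def using r by (intro the_equality) blast+
qed

lemma N_neg: "N p m n = 0" if "p > 1" "m < 0 \<or> n < 0"
proof -
  have "nat m < Suc (nat m)" by simp
  also have "Suc (nat m) < p ^ Suc (nat m)" using that(1) by (intro power_gt_expt) auto
  finally have "int (nat m) < int (p ^ Suc (nat m))" by (simp only: of_nat_less_iff)
  then have r: "m < int p ^ Suc (nat m)" by (simp only: of_nat_power)
  have "solutions p (Suc (nat m)) m n = {}"
  proof -
    have False if "(a, b) \<in> solutions p (Suc (nat m)) m n" for a b
    proof -
      have "int (2 * (\<Sum>i = 1..Suc (nat m). a i) + (\<Sum>j = 1..Suc (nat m). b j)) = n \<and>
          int (b 1 + (\<Sum>i = 1..Suc (nat m) - 1. (a i + b (i + 1)) * p ^ i)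
            + a (Suc (nat m)) * p ^ Suc (nat m)) = m"
        using that by (simp only: solutions_def mem_Collect_eq case_prod_conv)
      then show False using \<open>m < 0 \<or> n < 0\<close> by linarith
    qed
    then show ?thesis by fast
  qed
  then show ?thesis using N_eq_Nr[OF that(1) _ r] by (simp add: Nr_def)
qed

end

theory Submission imports Defs begin

text \<open>Splitting off the first entries \<open>x = a\<^sub>1\<close> and \<open>c = b\<^sub>1\<close> of a solution of length \<open>r + 1\<close>, the
  second equation reads \<open>m = c + p (x + m')\<close>, where the shifted tuples form a solution of
  length \<open>r\<close> for \<open>m'\<close> and \<open>n - 2 x - c\<close>. As \<open>c \<in> {0, 1}\<close> and \<open>p \<ge> 2\<close>, the residue of
  \<open>m\<close> modulo \<open>p\<close> determines \<open>c\<close>.\<close>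

definition tuple_cons :: "nat \<Rightarrow> (nat \<Rightarrow> nat) \<Rightarrow> nat \<Rightarrow> nat" where
  "tuple_cons x a = (\<lambda>i. if i = 0 then undefined else if i = 1 then x else a (i - 1))"

lemma tuple_cons_simps [simp]:
  "tuple_cons x a (Suc 0) = x"
  "i \<ge> 1 \<Longrightarrow> tuple_cons x a (Suc i) = a i"
  by (auto simp: tuple_cons_def)

lemma sum_tuple_cons: "(\<Sum>i = 1..Suc r. tuple_cons x a i) = x + (\<Sum>i = 1..r. a i)"
proof -
  have "(\<Sum>i = Suc 1..Suc r. tuple_cons x a i) = (\<Sum>i = 1..r. a i)"
    unfolding sum.shift_bounds_cl_Suc_ivl by (intro sum.cong) auto
  then show ?thesis by (simp add: sum.atLeast_Suc_atMost del: sum.cl_ivl_Suc)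
qed

text \<open>The value \<open>undefined\<close> at index 0, together with the defaults of
  \<open>a\<close> above \<open>r\<close> shifted by one, gives exactly the defaults required
  outside \<open>{1..Suc r}\<close>, so only the new head remains to be checked.\<close>

lemma tuple_cons_mem_PiE:
  assumes "a \<in> {1..r} \<rightarrow>\<^sub>E A"
  shows "tuple_cons x a \<in> {1..Suc r} \<rightarrow>\<^sub>E A \<longleftrightarrow> x \<in> A"
proof
  assume "tuple_cons x a \<in> {1..Suc r} \<rightarrow>\<^sub>E A"
  then have "tuple_cons x a 1 \<in> A" by (rule PiE_mem) simp
  then show "x \<in> A" by simp
next
  assume "x \<in> A"
  show "tuple_cons x a \<in> {1..Suc r} \<rightarrow>\<^sub>E A"
  proof (rule PiE_I)
    fix i assume i: "i \<in> {1..Suc r}"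
    show "tuple_cons x a i \<in> A"
    proof (cases "i = 1")
      case False
      then have "i - 1 \<in> {1..r}" using i by auto
      then show ?thesis using PiE_mem[OF assms] False i by (simp add: tuple_cons_def)
    qed (simp add: \<open>x \<in> A\<close>)
  next
    fix i assume i: "i \<notin> {1..Suc r}"
    show "tuple_cons x a i = undefined"
    proof (cases "i = 0")
      case False
      then have "i - 1 \<notin> {1..r}" "i \<noteq> 1" using i by auto
      then show ?thesis using PiE_arb[OF assms] False by (simp add: tuple_cons_def)
    qed (simp add: tuple_cons_def)
  qed
qed

lemma tuple_cons_cases:
  assumes "a \<in> {1..Suc r} \<rightarrow>\<^sub>E A" "r \<ge> 1"
  obtains x a' where "x \<in> A" "a' \<in> {1..r} \<rightarrow>\<^sub>E A" "a = tuple_cons x a'"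
proof
  show "a 1 \<in> A" using assms by auto
  let ?a' = "\<lambda>i. if i = 0 then undefined else a (Suc i)"
  show "?a' \<in> {1..r} \<rightarrow>\<^sub>E A"
    using assms by (auto simp: PiE_def Pi_def extensional_def)
  show "a = tuple_cons (a 1) ?a'"
    using assms by (auto simp: fun_eq_iff tuple_cons_def PiE_def extensional_def)
qed

text \<open>\<open>tuple_cons x a\<close> does not see \<open>a 0\<close>, so equality of the tails
  rests on extensionality, which makes both \<open>undefined\<close> there.\<close>

lemma tuple_cons_eq_iff:
  assumes "a \<in> {1..r} \<rightarrow>\<^sub>E A" "a' \<in> {1..r} \<rightarrow>\<^sub>E A"
  shows "tuple_cons x a = tuple_cons x' a' \<longleftrightarrow> x = x' \<and> a = a'"
proof
  assume eq: "tuple_cons x a = tuple_cons x' a'"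
  have "a i = a' i" if "i \<ge> 1" for i
    using fun_cong[OF eq, of "Suc i"] that by simp
  moreover have "a 0 = a' 0" using assms by (simp add: PiE_def extensional_def)
  ultimately have "a i = a' i" for i by (cases "i = 0") auto
  then show "x = x' \<and> a = a'" using fun_cong[OF eq, of 1] by auto
qed auto

text \<open>Prepending moves every term of the tail's weighted sum up one power of \<open>p\<close>;
  \<open>b 1\<close>, now at \<open>p ^ 1\<close>, joins the new entry \<open>x\<close> there. Hence
  everything except \<open>c\<close> has a factor \<open>p\<close>.\<close>

lemma weighted_sum_tuple_cons:
  assumes "r \<ge> 1"
  shows "tuple_cons c b 1 + (\<Sum>i = 1..Suc r - 1. (tuple_cons x a i + tuple_cons c b (i + 1)) * p ^ i)
      + tuple_cons x a (Suc r) * p ^ Suc r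
    = c + p * (x + (b 1 + (\<Sum>i = 1..r - 1. (a i + b (i + 1)) * p ^ i) + a r * p ^ r))"
proof -
  obtain s where s: "r = Suc s" using assms by (cases r) auto
  have "(\<Sum>i = 1..Suc s. (tuple_cons x a i + tuple_cons c b (i + 1)) * p ^ i)
      = (x + b 1) * p + (\<Sum>i = Suc 1..Suc s. (tuple_cons x a i + tuple_cons c b (i + 1)) * p ^ i)"
    by (simp add: sum.atLeast_Suc_atMost del: sum.cl_ivl_Suc)
  also have "(\<Sum>i = Suc 1..Suc s. (tuple_cons x a i + tuple_cons c b (i + 1)) * p ^ i)
      = p * (\<Sum>i = 1..s. (a i + b (i + 1)) * p ^ i)"
    unfolding sum.shift_bounds_cl_Suc_ivl sum_distrib_left by (intro sum.cong) auto
  finally show ?thesis using s by (simp add: algebra_simps del: sum.cl_ivl_Suc)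
qed

text \<open>The weight \<open>k\<close> of the tail stays existential here; it can be written as
  \<open>(m - int c) div int p - int x\<close> only once \<open>int p\<close> is known to divide
  \<open>m - int c\<close>.\<close>

lemma tuple_cons_mem_solutions:
  assumes "r \<ge> 1" "a \<in> {1..r} \<rightarrow>\<^sub>E UNIV" "b \<in> {1..r} \<rightarrow>\<^sub>E {0, 1}"
  shows "(tuple_cons x a, tuple_cons c b) \<in> solutions p (Suc r) m n \<longleftrightarrow>
    c \<in> {0, 1} \<and>
    (\<exists>k. m = int c + int p * (int x + k) \<and> (a, b) \<in> solutions p r k (n - 2 * int x - int c))"
  using assms
  unfolding solutions_def mem_Collect_eq case_prod_conv
    tuple_cons_mem_PiE[OF assms(2)] tuple_cons_mem_PiE[OF assms(3)]
    sum_tuple_cons weighted_sum_tuple_cons[OF assms(1)]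
  unfolding of_nat_add of_nat_mult
  by (auto simp del: of_nat_sum)

text \<open>Sorting the solutions by the first entry \<open>x\<close> of \<open>a\<close> gives
  disjoint classes, and deleting both first entries maps each class bijectively onto the solutions
  of length \<open>r\<close> for the reduced arguments.\<close>

lemma card_solutions_Suc:
  assumes "r \<ge> 1" "p > 0" "c \<in> {0, 1}" "int p dvd m - int c"
  shows "card {(a, b) \<in> solutions p (Suc r) m n. b 1 = c} =
    (\<Sum>x \<in> {0..n div 2}. Nr p r ((m - int c) div int p - x) (n - 2 * x - int c))"
proof -
  define S where "S x = solutions p r ((m - int c) div int p - x) (n - 2 * x - int c)" for x
  let ?h = "\<lambda>(x, a, b). (tuple_cons (nat x) a, tuple_cons c b)"
  have SD: "a \<in> {1..r} \<rightarrow>\<^sub>E UNIV" "b \<in> {1..r} \<rightarrow>\<^sub>E {0, 1}" if "(a, b) \<in> S x" for x a b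
    using that by (auto simp: S_def solutions_def)
  have k: "m = int c + int p * (x + k) \<longleftrightarrow> k = (m - int c) div int p - x" for k x
    using assms(2,4) by (auto simp: dvd_def)
  have "bij_betw ?h (SIGMA x:{0..n div 2}. S x) {(a, b) \<in> solutions p (Suc r) m n. b 1 = c}"
    unfolding bij_betw_def
  proof
    show "inj_on ?h (SIGMA x:{0..n div 2}. S x)"
    proof (rule inj_onI)
      fix u v assume *: "u \<in> (SIGMA x:{0..n div 2}. S x)" "v \<in> (SIGMA x:{0..n div 2}. S x)"
        "?h u = ?h v"
      obtain x a b where u: "u = (x, a, b)" "x \<ge> 0" "(a, b) \<in> S x" using *(1) by auto
      obtain y a' b' where v: "v = (y, a', b')" "y \<ge> 0" "(a', b') \<in> S y" using *(2) by auto
      \<comment> \<open>The map \<open>nat\<close> inside \<open>?h\<close> identifies no two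
        indices, since \<open>x\<close> and \<open>y\<close> are nonnegative.\<close>
      show "u = v"
        using *(3) u(2) v(2) eq_nat_nat_iff[OF u(2) v(2)] tuple_cons_eq_iff[OF SD(1)[OF u(3)] SD(1)[OF v(3)]]
          tuple_cons_eq_iff[OF SD(2)[OF u(3)] SD(2)[OF v(3)]]
        by (simp add: u(1) v(1))
    qed
    show "?h ` (SIGMA x:{0..n div 2}. S x) = {(a, b) \<in> solutions p (Suc r) m n. b 1 = c}"
    proof (intro equalityI subsetI)
      fix y assume "y \<in> ?h ` (SIGMA x:{0..n div 2}. S x)"
      then obtain x a b where *: "x \<in> {0..n div 2}" "(a, b) \<in> S x"
        "y = (tuple_cons (nat x) a, tuple_cons c b)" by auto
      have "y \<in> solutions p (Suc r) m n"
        unfolding *(3) tuple_cons_mem_solutions[OF assms(1) SD[OF *(2)]] k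
        using assms(3) * by (auto simp: S_def)
      then show "y \<in> {(a, b) \<in> solutions p (Suc r) m n. b 1 = c}" by (simp add: *(3))
    next
      fix y assume "y \<in> {(a, b) \<in> solutions p (Suc r) m n. b 1 = c}"
      then obtain a b where y: "y = (a, b)" "(a, b) \<in> solutions p (Suc r) m n" "b 1 = c" by auto
      then have ab_PiE: "a \<in> {1..Suc r} \<rightarrow>\<^sub>E UNIV" "b \<in> {1..Suc r} \<rightarrow>\<^sub>E {0, 1}"
        by (simp_all add: solutions_def)
      obtain x a' where a': "x \<in> UNIV" "a' \<in> {1..r} \<rightarrow>\<^sub>E UNIV" "a = tuple_cons x a'"
        using ab_PiE(1) assms(1) by (rule tuple_cons_cases)
      obtain c' b' where b': "c' \<in> {0, 1}" "b' \<in> {1..r} \<rightarrow>\<^sub>E {0, 1}" "b = tuple_cons c' b'"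
        using ab_PiE(2) assms(1) by (rule tuple_cons_cases)
      note ab = a'(2) b'(2) a'(3) b'(3)
      have "c' = c" using y(3) ab(4) by simp
      have S: "(a', b') \<in> S (int x)"
        using y(2) unfolding ab(3,4) tuple_cons_mem_solutions[OF assms(1) ab(1,2)] k \<open>c' = c\<close>
        by (auto simp: S_def)
      \<comment> \<open>This difference is a sum of naturals, so \<open>2 * int x\<close> cannot
        exceed \<open>n\<close>: the range \<open>{0..n div 2}\<close> misses no first
        entry.\<close>
      then have "n - 2 * int x - int c \<ge> 0"
        unfolding S_def solutions_def mem_Collect_eq case_prod_conv by linarith
      then have "int x \<in> {0..n div 2}" by simp
      then show "y \<in> ?h ` (SIGMA x:{0..n div 2}. S x)"
        using S y(1) ab \<open>c' = c\<close> by (intro image_eqI[of _ _ "(int x, a', b')"]) auto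
    qed
  qed
  then have "card {(a, b) \<in> solutions p (Suc r) m n. b 1 = c} = card (SIGMA x:{0..n div 2}. S x)"
    by (rule bij_betw_same_card[symmetric])
  also have "\<dots> = (\<Sum>x \<in> {0..n div 2}. card (S x))"
    by (rule card_SigmaI) (auto simp: S_def finite_solutions)
  finally show ?thesis by (simp add: S_def Nr_def)
qed

text \<open>Splitting off the first entries exhibits \<open>m - int (b 1)\<close> as a multiple of
  \<open>int p\<close>. This serves both to recover \<open>b 1\<close> from \<open>m\<close> and to
  exclude residues of \<open>m\<close> other than 0 and 1.\<close>

lemma solutions_dvd_minus_first:
  assumes "r \<ge> 1" "(a, b) \<in> solutions p (Suc r) m n"
  shows "b 1 \<in> {0, 1} \<and> int p dvd m - int (b 1)"
proof -
  have ab_PiE: "a \<in> {1..Suc r} \<rightarrow>\<^sub>E UNIV" "b \<in> {1..Suc r} \<rightarrow>\<^sub>E {0, 1}"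
    using assms(2) by (simp_all add: solutions_def)
  obtain x a' where a': "x \<in> UNIV" "a' \<in> {1..r} \<rightarrow>\<^sub>E UNIV" "a = tuple_cons x a'"
    using ab_PiE(1) assms(1) by (rule tuple_cons_cases)
  obtain c b' where b': "c \<in> {0, 1}" "b' \<in> {1..r} \<rightarrow>\<^sub>E {0, 1}" "b = tuple_cons c b'"
    using ab_PiE(2) assms(1) by (rule tuple_cons_cases)
  note ab = a'(2) b'(2) a'(3) b'(3)
  show ?thesis
    using assms(2) unfolding ab(3,4) tuple_cons_mem_solutions[OF assms(1) ab(1,2)] by auto
qed

text \<open>Both bounds are wanted: length \<open>Suc r\<close> computes the left side of the
  recursion, length \<open>r\<close> its summands.\<close>

lemma ex_power_greater:
  assumes "p > 1"
  shows "\<exists>r\<ge>1. int p ^ r > m \<and> int p ^ Suc r > m"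
proof -
  have gt: "int p ^ r > m" if "r > nat m" for r
  proof -
    have "r < p ^ r" using power_gt_expt[of p r] assms by simp
    then have "int r < int (p ^ r)" by (simp only: of_nat_less_iff)
    then show ?thesis using that by (simp only: of_nat_power)
  qed
  show ?thesis
    using gt[of "Suc (nat m)"] gt[of "Suc (Suc (nat m))"]
    by (intro exI[of _ "Suc (nat m)"]) simp
qed

text \<open>Here \<open>c\<close> is the value that the residue of \<open>m\<close> forces on
  \<open>b 1\<close> in every solution, so the count for \<open>b 1 = c\<close> is the full
  count.\<close>

lemma N_recursion:
  assumes "p > 1" "m \<ge> 0" "c \<in> {0, 1}" "int p dvd m - int c"
  shows "N p m n = (\<Sum>x \<in> {0..n div 2}. N p ((m - int c) div int p - x) (n - 2 * x - int c))"
proof -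
  obtain r where r: "r \<ge> 1" "int p ^ r > m" "int p ^ Suc r > m"
    using ex_power_greater[OF assms(1)] by blast
  then have "N p m n = card (solutions p (Suc r) m n)"
    using N_eq_Nr[OF assms(1), of "Suc r"] by (simp add: Nr_def)
  also have "solutions p (Suc r) m n = {(a, b) \<in> solutions p (Suc r) m n. b 1 = c}"
  proof -
    have "b 1 = c" if "(a, b) \<in> solutions p (Suc r) m n" for a b
    proof -
      have b: "b 1 \<in> {0, 1}" "int p dvd m - int (b 1)"
        using solutions_dvd_minus_first[OF r(1) that] by auto
      \<comment> \<open>Two elements of \<open>{0, 1}\<close> differ by at most 1, which is less
        than \<open>p\<close>, so divisibility by \<open>p\<close> makes them equal.\<close>
      have "int p dvd int (b 1) - int c"
        using dvd_diff[OF assms(4) b(2)] by simp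
      moreover have "\<bar>int (b 1) - int c\<bar> < int p" using b(1) assms(1,3) by auto
      ultimately show ?thesis using dvd_imp_le_int[of "int (b 1) - int c" "int p"] by auto
    qed
    then show ?thesis by auto
  qed
  also have "card \<dots> = (\<Sum>x \<in> {0..n div 2}. Nr p r ((m - int c) div int p - x) (n - 2 * x - int c))"
    using assms r by (intro card_solutions_Suc) auto
  also have "\<dots> = (\<Sum>x \<in> {0..n div 2}. N p ((m - int c) div int p - x) (n - 2 * x - int c))"
  proof (intro sum.cong refl)
    fix x assume "x \<in> {0..n div 2}"
    \<comment> \<open>The first arguments of all summands thus stay below \<open>int p ^ r\<close>,
      and one length \<open>r\<close> computes every summand.\<close>
    moreover have "(m - int c) div int p \<le> m"
      using zdiv_mono1[of "m - int c" m "int p"] zdiv_mono2[of m 1 "int p"] assms(1,2) by simp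
    ultimately have "(m - int c) div int p - x < int p ^ r" using r(2) by simp
    then show "Nr p r ((m - int c) div int p - x) (n - 2 * x - int c) =
        N p ((m - int c) div int p - x) (n - 2 * x - int c)"
      using N_eq_Nr[OF assms(1) r(1)] by simp
  qed
  finally show ?thesis .
qed

lemma N_eq_0:
  assumes "p > 1" "\<not> int p dvd m" "\<not> int p dvd m - 1"
  shows "N p m n = 0"
proof -
  obtain r where r: "r \<ge> 1" "int p ^ Suc r > m"
    using ex_power_greater[OF assms(1)] by blast
  then have "N p m n = card (solutions p (Suc r) m n)"
    using N_eq_Nr[OF assms(1), of "Suc r"] by (simp add: Nr_def)
  also have "solutions p (Suc r) m n = {}"
    using solutions_dvd_minus_first[of r _ _ p m n] r(1) assms(2,3) by fastforce
  finally show ?thesis by simp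
qed

theorem proposition3p4:
  fixes p :: nat and m n :: int
  assumes "prime p" and "odd p" and "m \<ge> 0" and "n \<ge> 0"
  shows "N p m n =
    (if int p dvd m then \<Sum>a \<in> {0..n div 2}. N p (m div int p - a) (n - 2 * a)
     else if [m = 1] (mod int p) then \<Sum>a \<in> {0..n div 2}. N p ((m - 1) div int p - a) (n - 2 * a - 1)
     else 0)"
proof -
  have p: "p > 1" using assms(1) by (rule prime_gt_1_nat)
  \<comment> \<open>The recursion for \<open>c = 0\<close> and \<open>c = 1\<close> and the
    vanishing case match the three branches once the congruence is read as
    \<open>int p dvd m - 1\<close>.\<close>
  show ?thesis
    using N_recursion[OF p assms(3), of 0 n] N_recursion[OF p assms(3), of 1 n]
      N_eq_0[OF p]
    by (simp add: cong_iff_dvd_diff)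
qed

end
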